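(* Let $R$ be a commutative ring with unity, $Y\subseteq\mathrm{Spec}(R)$ and $I$ an ideal of $R$. Then the following are equivalent: (a) For every $a\in I$ and $S\subseteq R$, $h_Y(a)\subseteq h_Y(S)$ implies $S\subseteq I$. (b) For every $a\in I$ and $S\subseteq R$, $h_Y(a)=h_Y(S)$ implies $S\subseteq I$. (c) For every $a\in I$ and $b\in R$, $h_Y(a)=h_Y(b)$ implies $b\in I$. (d) For every $a\in I$ and $b\in R$, $h_Y(a)\subseteq h_Y(b)$ implies $b\in I$. (e) If $a\in I$, then $kh_Y(a)\subseteq I$. (f) For every $a\in I$ and $S\subseteq R$, $kh_Y(S)\subseteq kh_Y(a)$ implies $S\subseteq I$. (g) For every $a\in I$ and $S\subseteq R$, $kh_Y(S)=kh_Y(a)$ implies $S\subseteq I$. (h) For every $a\in I$ and $b\in R$, $kh_Y(b)=kh_Y(a)$ implies $b\in I$. (k) For every $a\in I$ and $b\in R$, $kh_Y(b)\subseteq kh_Y(a)$ implies $b\in I$.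
   Context: $h_Y(S)=\{P\in Y: S\subseteq P\}$ for $S\subseteq R$, $h_Y(a)=h_Y(\{a\})$, and for $X\subseteq Y$, $k(X)=\bigcap_{P\in X}P$ (with $k(\emptyset)=R$); $kh_Y(S)=k(h_Y(S))$ and $kh_Y(a)=k(h_Y(a))$. *)

theory Defs
  imports "HOL-Algebra.Ideal"
begin

definition Spec :: "('a, 'm) ring_scheme \<Rightarrow> 'a set set" where
  "Spec R = {P. primeideal P R}"

definition h_set :: "'a set set \<Rightarrow> 'a set \<Rightarrow> 'a set set" where
  "h_set Y S = {P \<in> Y. S \<subseteq> P}"

abbreviation h_elem :: "'a set set \<Rightarrow> 'a \<Rightarrow> 'a set set" where
  "h_elem Y a \<equiv> h_set Y {a}"

(* In HOL, the intersection of the empty family is UNIV, not the carrier of R. *)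
definition k_set :: "('a, 'm) ring_scheme \<Rightarrow> 'a set set \<Rightarrow> 'a set" where
  "k_set R X = (if X = {} then carrier R else \<Inter>X)"

abbreviation kh_set :: "('a, 'm) ring_scheme \<Rightarrow> 'a set set \<Rightarrow> 'a set \<Rightarrow> 'a set" where
  "kh_set R Y S \<equiv> k_set R (h_set Y S)"

abbreviation kh_elem :: "('a, 'm) ring_scheme \<Rightarrow> 'a set set \<Rightarrow> 'a \<Rightarrow> 'a set" where
  "kh_elem R Y a \<equiv> k_set R (h_elem Y a)"

definition all_equivalent :: "bool list \<Rightarrow> bool" where
  "all_equivalent ps \<longleftrightarrow> (\<forall>p \<in> set ps. \<forall>q \<in> set ps. p \<longleftrightarrow> q)"

end

(* The maps h_Y and k form a Galois connection, so (in)equalities between hulls and between their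
   kernels are interchangeable. The only step that uses primality is (c) \<Longrightarrow> (d): if
   h_Y(a) \<subseteq> h_Y(b) then h_Y(a b) = h_Y(a) \<union> h_Y(b) = h_Y(b), and a b lies in I. *)
theory Submission
  imports Defs
begin

text \<open>Shape of the main argument: four conditions form a cycle of implications, and each of
  the other five restates one of these four.\<close>

lemma all_equivalent_cycle_copiesI:
  assumes "a \<longrightarrow> b" "b \<longrightarrow> c" "c \<longrightarrow> d" "d \<longrightarrow> a"
    and "e \<longleftrightarrow> d" "f \<longleftrightarrow> a" "k \<longleftrightarrow> d" "g \<longleftrightarrow> b" "h \<longleftrightarrow> c"
  shows "all_equivalent [a, b, c, d, e, f, g, h, k]"
proof -
  have "b \<longleftrightarrow> a" "c \<longleftrightarrow> a" "d \<longleftrightarrow> a"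
    using assms(1-4) by iprover+
  with assms(5-9) show ?thesis
    by (simp add: all_equivalent_def)
qed

text \<open>The Galois law: both sides say that every member of \<open>Y\<close> containing
  \<open>T\<close> contains \<open>S\<close>. If \<open>T\<close> has empty hull, the kernel is
  \<open>carrier R\<close>, and the assumption on \<open>S\<close> settles that case.\<close>

lemma subset_k_set_iff:
  assumes "S \<subseteq> carrier R"
  shows "S \<subseteq> k_set R (h_set Y T) \<longleftrightarrow> h_set Y T \<subseteq> h_set Y S"
  using assms by (auto simp: k_set_def h_set_def)

text \<open>A nonempty hull has a member, an ideal that contains the kernel. This makes the Galois
  law applicable to kernels themselves.\<close>

lemma k_set_subset_carrier:
  assumes "Y \<subseteq> Spec R"
  shows "k_set R (h_set Y S) \<subseteq> carrier R"
proof (cases "h_set Y S = {}")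
  case True
  then show ?thesis
    by (simp add: k_set_def)
next
  case False
  then obtain P where P: "P \<in> h_set Y S"
    by blast
  then have "P \<in> Y"
    by (simp add: h_set_def)
  then interpret primeideal P R
    using assms by (auto simp: Spec_def)
  have "k_set R (h_set Y S) \<subseteq> P"
    using P by (auto simp: k_set_def)
  then show ?thesis
    using a_subset by (rule subset_trans)
qed

lemma kh_set_subset_iff:
  assumes "Y \<subseteq> Spec R" "S \<subseteq> carrier R"
  shows "kh_set R Y S \<subseteq> kh_set R Y T \<longleftrightarrow> h_set Y T \<subseteq> h_set Y S"
proof
  have "S \<subseteq> kh_set R Y S"
    using subset_k_set_iff[OF assms(2)] by (rule iffD2) simp
  also assume "kh_set R Y S \<subseteq> kh_set R Y T"
  finally show "h_set Y T \<subseteq> h_set Y S"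
    using subset_k_set_iff[OF assms(2)] by (rule iffD1[rotated])
next
  \<comment> \<open>The Galois law with a kernel as the set on the left; reflexivity of inclusion
    then shows that each prime in the hull of \<open>S\<close> contains the kernel of that
    hull.\<close>
  note iff = subset_k_set_iff[OF k_set_subset_carrier[OF assms(1)]]
  assume "h_set Y T \<subseteq> h_set Y S"
  also have "h_set Y S \<subseteq> h_set Y (kh_set R Y S)"
    using iff by (rule iffD1) simp
  finally show "kh_set R Y S \<subseteq> kh_set R Y T"
    using iff by (rule iffD2[rotated])
qed

lemma kh_set_eq_iff:
  assumes "Y \<subseteq> Spec R" "S \<subseteq> carrier R" "T \<subseteq> carrier R"
  shows "kh_set R Y S = kh_set R Y T \<longleftrightarrow> h_set Y T = h_set Y S"
  unfolding set_eq_subset kh_set_subset_iff[OF assms(1,2)] kh_set_subset_iff[OF assms(1,3)] ..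

text \<open>For each prime in \<open>Y\<close>, primality gives the inclusion from left to right and
  absorption of products the converse.\<close>

lemma h_elem_mult:
  assumes "Y \<subseteq> Spec R" "a \<in> carrier R" "b \<in> carrier R"
  shows "h_elem Y (a \<otimes>\<^bsub>R\<^esub> b) = h_elem Y a \<union> h_elem Y b"
proof -
  have "a \<otimes>\<^bsub>R\<^esub> b \<in> P \<longleftrightarrow> a \<in> P \<or> b \<in> P" if "P \<in> Y" for P
  proof -
    interpret primeideal P R
      using assms(1) that by (auto simp: Spec_def)
    show ?thesis
      using I_prime[OF assms(2,3)] I_r_closed[OF _ assms(3), of a] I_l_closed[OF _ assms(2), of b]
      by blast
  qed
  then show ?thesis
    by (auto simp: h_set_def)
qed

theorem proposition3p2:
  fixes R :: "('a, 'm) ring_scheme" and Y :: "'a set set" and I :: "'a set"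
  assumes "cring R" and "Y \<subseteq> Spec R" and "ideal I R"
  shows "all_equivalent
    [\<forall>a \<in> I. \<forall>S. S \<subseteq> carrier R \<longrightarrow> h_elem Y a \<subseteq> h_set Y S \<longrightarrow> S \<subseteq> I,
     \<forall>a \<in> I. \<forall>S. S \<subseteq> carrier R \<longrightarrow> h_elem Y a = h_set Y S \<longrightarrow> S \<subseteq> I,
     \<forall>a \<in> I. \<forall>b \<in> carrier R. h_elem Y a = h_elem Y b \<longrightarrow> b \<in> I,
     \<forall>a \<in> I. \<forall>b \<in> carrier R. h_elem Y a \<subseteq> h_elem Y b \<longrightarrow> b \<in> I,
     \<forall>a \<in> I. kh_elem R Y a \<subseteq> I,
     \<forall>a \<in> I. \<forall>S. S \<subseteq> carrier R \<longrightarrow> kh_set R Y S \<subseteq> kh_elem R Y a \<longrightarrow> S \<subseteq> I,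
     \<forall>a \<in> I. \<forall>S. S \<subseteq> carrier R \<longrightarrow> kh_set R Y S = kh_elem R Y a \<longrightarrow> S \<subseteq> I,
     \<forall>a \<in> I. \<forall>b \<in> carrier R. kh_elem R Y b = kh_elem R Y a \<longrightarrow> b \<in> I,
     \<forall>a \<in> I. \<forall>b \<in> carrier R. kh_elem R Y b \<subseteq> kh_elem R Y a \<longrightarrow> b \<in> I]"
  (is "all_equivalent [?a, ?b, ?c, ?d, ?e, ?f, ?g, ?h, ?k]")
proof -
  interpret ideal I R by fact
  note Y = \<open>Y \<subseteq> Spec R\<close>
  have I: "a \<in> carrier R" if "a \<in> I" for a
    using that by (rule a_Hcarr)
  have "?a \<longrightarrow> ?b" by blast
  moreover have "?b \<longrightarrow> ?c"
  proof (intro ballI impI)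
    fix a b
    assume ?b "a \<in> I" "b \<in> carrier R" "h_elem Y a = h_elem Y b"
    \<comment> \<open>Take \<open>S\<close> to be \<open>{b}\<close>, since
      \<open>h_elem Y b\<close> abbreviates \<open>h_set Y {b}\<close>.\<close>
    then have "{b} \<subseteq> I" by blast
    then show "b \<in> I" by blast
  qed
  moreover have "?c \<longrightarrow> ?d"
  proof (intro ballI impI)
    fix a b
    assume c: ?c and a: "a \<in> I" and b: "b \<in> carrier R" and le: "h_elem Y a \<subseteq> h_elem Y b"
    have "h_elem Y (a \<otimes>\<^bsub>R\<^esub> b) = h_elem Y b"
      using h_elem_mult[OF Y I[OF a] b] le by blast
    then show "b \<in> I"
      using c I_r_closed[OF a b] b by blast
  qed
  moreover have "?d \<longrightarrow> ?a"
  proof (intro ballI allI impI subsetI)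
    fix a S b
    assume d: ?d and a: "a \<in> I" and S: "S \<subseteq> carrier R" "b \<in> S"
      and le: "h_elem Y a \<subseteq> h_set Y S"
    \<comment> \<open>Hulls reverse inclusion, so a set \<open>S\<close> can be treated one element
      at a time.\<close>
    have "h_set Y S \<subseteq> h_elem Y b"
      using S(2) by (auto simp: h_set_def)
    with le d a S show "b \<in> I" by blast
  qed
  moreover have "?e \<longleftrightarrow> ?d"
  proof -
    \<comment> \<open>The Galois law for the singleton \<open>{b}\<close>: membership in the kernel
      is exactly the premise of \<open>?d\<close>.\<close>
    have "b \<in> kh_elem R Y a \<longleftrightarrow> b \<in> carrier R \<and> h_elem Y a \<subseteq> h_elem Y b" for a b
      using k_set_subset_carrier[OF Y, of "{a}"] subset_k_set_iff[of "{b}" R Y "{a}"] by auto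
    then show ?thesis by blast
  qed
  moreover have "?f \<longleftrightarrow> ?a" "?k \<longleftrightarrow> ?d"
    by (simp_all add: kh_set_subset_iff[OF Y])
  \<comment> \<open>Equality takes the inclusion law in both directions, so \<open>a\<close> must
    also lie in the carrier; \<open>I\<close> supplies this.\<close>
  moreover have "?g \<longleftrightarrow> ?b" "?h \<longleftrightarrow> ?c"
    by (simp_all add: kh_set_eq_iff[OF Y] I)
  ultimately show ?thesis
    by (rule all_equivalent_cycle_copiesI)
qed

end
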